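(* Let $s$ be a positive integer. Then there exist a finite connected bridgeless planar graph $G$, embedded in the plane, and a signature in $G$ with multiplicity $s$; that is, a cycle $C$ in $G$ such that exactly $s$ cycles in $G$ (including $C$ itself) have the same signature as $C$.
   Context: For a planar graph $G$ embedded in the plane and a cycle $C$ in $G$, the signature of $C$ in $G$ is the function assigning to each finite (i.e. bounded) face $F$ of $G$ the number of edges of $F$ (edges on the boundary of $F$) which belong to $C$. The exterior (unbounded) face receives no number. The multiplicity of a signature $S$ is the total number of cycles in $G$ whose signature is $S$. *)

theory Defs
  imports "HOL-Analysis.Analysis"
begin

text \<open>
  Graphs are finite and simple: edges are two-element sets of vertices. A plane graph has points
  of the complex plane as vertices, and \<open>\<gamma> e\<close> is the arc by which the edge \<open>e\<close> is drawn.
\<close>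

definition simple_graph :: "'a set \<Rightarrow> 'a set set \<Rightarrow> bool" where
  "simple_graph V E \<longleftrightarrow> finite V \<and> (\<forall>e\<in>E. e \<subseteq> V \<and> card e = 2)"

definition joined :: "'a set set \<Rightarrow> 'a \<Rightarrow> 'a \<Rightarrow> bool" where
  "joined E u v \<longleftrightarrow> (u, v) \<in> {(x, y). {x, y} \<in> E}\<^sup>*"

definition connected_graph :: "'a set \<Rightarrow> 'a set set \<Rightarrow> bool" where
  "connected_graph V E \<longleftrightarrow> V \<noteq> {} \<and> (\<forall>u\<in>V. \<forall>v\<in>V. joined E u v)"

definition is_bridge :: "'a set set \<Rightarrow> 'a set \<Rightarrow> bool" where
  "is_bridge E e \<longleftrightarrow> e \<in> E \<and> (\<exists>u v. joined E u v \<and> \<not> joined (E - {e}) u v)"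

definition bridgeless :: "'a set set \<Rightarrow> bool" where
  "bridgeless E \<longleftrightarrow> (\<forall>e\<in>E. \<not> is_bridge E e)"

text \<open>A cycle is identified with its edge set, so rotations and reversals of the same cyclic
  sequence of vertices are not distinguished.\<close>

definition is_cycle :: "'a set set \<Rightarrow> 'a set set \<Rightarrow> bool" where
  "is_cycle E C \<longleftrightarrow> C \<subseteq> E \<and>
     (\<exists>vs. length vs \<ge> 3 \<and> distinct vs \<and>
           C = {{vs ! i, vs ! (Suc i mod length vs)} | i. i < length vs})"

definition plane_graph ::
    "complex set \<Rightarrow> complex set set \<Rightarrow> (complex set \<Rightarrow> real \<Rightarrow> complex) \<Rightarrow> bool" where
  "plane_graph V E \<gamma> \<longleftrightarrow> simple_graph V E \<and>
     (\<forall>e\<in>E. arc (\<gamma> e) \<and> {pathstart (\<gamma> e), pathfinish (\<gamma> e)} = e \<and>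
            path_image (\<gamma> e) \<inter> V = e) \<and>
     (\<forall>e\<in>E. \<forall>f\<in>E. e \<noteq> f \<longrightarrow> path_image (\<gamma> e) \<inter> path_image (\<gamma> f) \<subseteq> e \<inter> f)"

definition drawing ::
    "complex set \<Rightarrow> complex set set \<Rightarrow> (complex set \<Rightarrow> real \<Rightarrow> complex) \<Rightarrow> complex set" where
  "drawing V E \<gamma> = V \<union> (\<Union>e\<in>E. path_image (\<gamma> e))"

definition faces ::
    "complex set \<Rightarrow> complex set set \<Rightarrow> (complex set \<Rightarrow> real \<Rightarrow> complex) \<Rightarrow> complex set set" where
  "faces V E \<gamma> = components (- drawing V E \<gamma>)"

definition finite_faces ::
    "complex set \<Rightarrow> complex set set \<Rightarrow> (complex set \<Rightarrow> real \<Rightarrow> complex) \<Rightarrow> complex set set" where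
  "finite_faces V E \<gamma> = {F \<in> faces V E \<gamma>. bounded F}"

definition face_edges ::
    "complex set set \<Rightarrow> (complex set \<Rightarrow> real \<Rightarrow> complex) \<Rightarrow> complex set \<Rightarrow> complex set set" where
  "face_edges E \<gamma> F = {e \<in> E. path_image (\<gamma> e) \<subseteq> frontier F}"

text \<open>The restriction makes two signatures equal as functions precisely when they agree on all
  bounded faces.\<close>

definition signature ::
    "complex set \<Rightarrow> complex set set \<Rightarrow> (complex set \<Rightarrow> real \<Rightarrow> complex) \<Rightarrow> complex set set
      \<Rightarrow> complex set \<Rightarrow> nat" where
  "signature V E \<gamma> C = (\<lambda>F\<in>finite_faces V E \<gamma>. card (face_edges E \<gamma> F \<inter> C))"

definition signature_multiplicity ::
    "complex set \<Rightarrow> complex set set \<Rightarrow> (complex set \<Rightarrow> real \<Rightarrow> complex)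
      \<Rightarrow> (complex set \<Rightarrow> nat) \<Rightarrow> nat" where
  "signature_multiplicity V E \<gamma> S = card {C. is_cycle E C \<and> signature V E \<gamma> C = S}"

end

theory Submission
  imports Defs
begin

text \<open>
  Three curves over \<open>[0, 2 n]\<close> are drawn above each other; the upper two touch at every even
  abscissa and enclose \<open>n\<close> lenses, and the lowest one meets the middle one only at the two ends
  and closes a belly. Vertices sit at the integer abscissae. Each lens has two edges on either
  side, so passing it above or below contributes 2 to its face in both cases; the belly then counts
  its \<open>2 n\<close> lowest edges plus 2 for every lens that is passed below. The cycles that follow the
  lowest curve and pass exactly one lens below therefore share a signature, and there are \<open>n\<close> of
  them. Conversely, a cycle has no vertex of degree one, hence it uses the two edges on a side of a
  lens together, and the lowest curve entirely or not at all. The value 2 on every lens forces one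
  side to be used, and the value \<open>2 n + 2\<close> on the belly can only be reached with the lowest curve.
\<close>

section \<open>Regions between two graphs of functions\<close>

definition region :: "real \<Rightarrow> real \<Rightarrow> (real \<Rightarrow> real) \<Rightarrow> (real \<Rightarrow> real) \<Rightarrow> complex set" where
  "region a b g h = {z. a < Re z \<and> Re z < b \<and> g (Re z) < Im z \<and> Im z < h (Re z)}"

definition closed_region :: "real \<Rightarrow> real \<Rightarrow> (real \<Rightarrow> real) \<Rightarrow> (real \<Rightarrow> real) \<Rightarrow> complex set" where
  "closed_region a b g h = {z. a \<le> Re z \<and> Re z \<le> b \<and> g (Re z) \<le> Im z \<and> Im z \<le> h (Re z)}"

text \<open>Slides every vertical segment affinely between the two graphs, so that connectedness,
  compactness and closures of regions are inherited from rectangles.\<close>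

definition shear :: "(real \<Rightarrow> real) \<Rightarrow> (real \<Rightarrow> real) \<Rightarrow> real \<times> real \<Rightarrow> complex" where
  "shear g h = (\<lambda>(x, t). Complex x (g x + t * (h x - g x)))"

lemma continuous_on_shear:
  assumes "continuous_on UNIV g" "continuous_on UNIV h"
  shows "continuous_on S (shear g h)"
proof -
  have "continuous_on S (\<lambda>p. g (fst p))" "continuous_on S (\<lambda>p. h (fst p))"
    by (intro assms[THEN continuous_on_compose2] continuous_intros subset_UNIV)+
  then show ?thesis
    unfolding shear_def case_prod_beta by (intro continuous_intros) auto
qed

lemma open_region:
  assumes "continuous_on UNIV g" "continuous_on UNIV h"
  shows "open (region a b g h)"
proof -
  have "continuous_on UNIV (\<lambda>z. g (Re z))" "continuous_on UNIV (\<lambda>z. h (Re z))"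
    by (intro assms[THEN continuous_on_compose2] continuous_intros subset_UNIV)+
  then show ?thesis
    unfolding region_def by (intro open_Collect_conj open_Collect_less continuous_intros)
qed

lemma region_eq_image:
  assumes "\<And>x. a < x \<Longrightarrow> x < b \<Longrightarrow> g x < h x"
  shows "region a b g h = shear g h ` ({a<..<b} \<times> {0<..<1})"
proof (intro equalityI subsetI)
  fix z assume z: "z \<in> region a b g h"
  then have lt: "g (Re z) < h (Re z)" using assms by (auto simp: region_def)
  define t where "t = (Im z - g (Re z)) / (h (Re z) - g (Re z))"
  have "(Re z, t) \<in> {a<..<b} \<times> {0<..<1}"
    using z lt by (auto simp: region_def t_def divide_simps)
  moreover have "z = shear g h (Re z, t)"
    using lt by (simp add: shear_def t_def complex_eq_iff)
  ultimately show "z \<in> shear g h ` ({a<..<b} \<times> {0<..<1})" by blast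
next
  fix z assume "z \<in> shear g h ` ({a<..<b} \<times> {0<..<1})"
  then obtain x t where x: "a < x" "x < b" and t: "0 < t" "t < 1"
    and z: "z = Complex x (g x + t * (h x - g x))" by (auto simp: shear_def)
  have "0 < (1 - t) * (h x - g x)" "0 < t * (h x - g x)"
    using t assms[OF x] by auto
  then show "z \<in> region a b g h"
    using x by (auto simp: region_def z algebra_simps)
qed

lemma closed_region_eq_image:
  assumes "\<And>x. a \<le> x \<Longrightarrow> x \<le> b \<Longrightarrow> g x \<le> h x"
  shows "closed_region a b g h = shear g h ` ({a..b} \<times> {0..1})"
proof (intro equalityI subsetI)
  fix z assume z: "z \<in> closed_region a b g h"
  \<comment> \<open>Where the graphs touch, division by zero gives \<open>t = 0\<close>, which is
    still a correct parameter because \<open>Im z = g (Re z)\<close> there.\<close>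
  define t where "t = (Im z - g (Re z)) / (h (Re z) - g (Re z))"
  have "(Re z, t) \<in> {a..b} \<times> {0..1}"
    using z by (auto simp: closed_region_def t_def divide_simps)
  moreover have "z = shear g h (Re z, t)"
    using z by (auto simp: closed_region_def shear_def t_def complex_eq_iff)
  ultimately show "z \<in> shear g h ` ({a..b} \<times> {0..1})" by blast
next
  fix z assume "z \<in> shear g h ` ({a..b} \<times> {0..1})"
  then obtain x t where x: "a \<le> x" "x \<le> b" and t: "0 \<le> t" "t \<le> 1"
    and z: "z = Complex x (g x + t * (h x - g x))" by (auto simp: shear_def)
  have "0 \<le> (1 - t) * (h x - g x)" "0 \<le> t * (h x - g x)"
    using t assms[OF x] by auto
  then show "z \<in> closed_region a b g h"
    using x by (auto simp: closed_region_def z algebra_simps)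
qed

text \<open>Strictness is confined to the open interval: the two sides of a face meet over its
  ends.\<close>

context
  fixes a b :: real and g h :: "real \<Rightarrow> real"
  assumes ab: "a < b"
    and cont: "continuous_on UNIV g" "continuous_on UNIV h"
    and less: "\<And>x. a < x \<Longrightarrow> x < b \<Longrightarrow> g x < h x"
    and ends: "g a \<le> h a" "g b \<le> h b"
begin

lemma region_le: "a \<le> x \<Longrightarrow> x \<le> b \<Longrightarrow> g x \<le> h x"
  using less[of x] ends by (cases "x = a"; cases "x = b") auto

lemma region_image: "region a b g h = shear g h ` ({a<..<b} \<times> {0<..<1})"
  by (rule region_eq_image) (rule less)

lemma closed_region_image: "closed_region a b g h = shear g h ` ({a..b} \<times> {0..1})"
  by (rule closed_region_eq_image) (rule region_le)

lemma compact_closed_region: "compact (closed_region a b g h)"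
  unfolding closed_region_image
  by (intro compact_continuous_image continuous_on_shear cont compact_Times) auto

lemma region_subset_closed_region: "region a b g h \<subseteq> closed_region a b g h"
  by (auto simp: region_def closed_region_def)

lemma bounded_region: "bounded (region a b g h)"
  using compact_closed_region region_subset_closed_region bounded_subset compact_imp_bounded
  by blast

text \<open>The closed region is compact, hence closed; conversely a continuous map sends the
  closure of the open rectangle into the closure of its image.\<close>

lemma closure_region: "closure (region a b g h) = closed_region a b g h"
proof
  show "closure (region a b g h) \<subseteq> closed_region a b g h"
    by (simp add: closure_minimal compact_closed_region compact_imp_closed
        region_subset_closed_region)
  have "closure ({a<..<b} \<times> {0<..<1::real}) = {a..b} \<times> {0..1}"
    using ab by (simp add: closure_Times closure_greaterThanLessThan)
  moreover have "shear g h ` closure ({a<..<b} \<times> {0<..<1}) \<subseteq>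
      closure (shear g h ` ({a<..<b} \<times> {0<..<1}))"
    by (intro image_closure_subset continuous_on_shear cont closed_closure closure_subset)
  ultimately show "closed_region a b g h \<subseteq> closure (region a b g h)"
    by (simp add: closed_region_image region_image)
qed

lemma frontier_region: "frontier (region a b g h) = closed_region a b g h - region a b g h"
  by (simp add: frontier_def closure_region interior_open open_region cont)

lemma connected_region: "connected (region a b g h)"
  unfolding region_image
  by (intro connected_continuous_image continuous_on_shear cont connected_Times) auto

lemma region_nonempty: "region a b g h \<noteq> {}"
  using ab unfolding region_image by auto

end

section \<open>Components, joined vertices and cycles\<close>

text \<open>A connected set properly extending \<open>S\<close> meets both \<open>S\<close> and its
  complement, hence the frontier of \<open>S\<close>, which lies outside \<open>U\<close>. So
  \<open>S\<close> is maximal.\<close>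

lemma component_if_frontier_disjoint:
  fixes S :: "'a::real_normed_vector set"
  assumes "connected S" "S \<noteq> {}" "S \<subseteq> U" "frontier S \<inter> U = {}"
  shows "S \<in> components U"
proof -
  have "T = S" if "S \<subseteq> T" "T \<subseteq> U" "connected T" for T
  proof (rule ccontr)
    assume "T \<noteq> S"
    then have "T - S \<noteq> {}" "T \<inter> S \<noteq> {}" using that assms(2) by auto
    then have "T \<inter> frontier S \<noteq> {}" using connected_Int_frontier that(3) by blast
    then show False using that assms(4) by blast
  qed
  then show ?thesis using assms by (auto simp: in_components_maximal)
qed

text \<open>Serves to show that a point from which a vertical ray avoids the drawing cannot lie in a
  bounded face.\<close>

lemma unbounded_vertical_rays:
  "\<not> bounded {z. Re z = x \<and> y \<le> Im z}" "\<not> bounded {z. Re z = x \<and> Im z \<le> y}"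
proof -
  have *: False if "bounded S" "\<And>t. f t \<in> S \<and> t \<le> \<bar>Im (f t)\<bar>" for S and f :: "real \<Rightarrow> complex"
  proof -
    from that(1) obtain B where B: "\<And>z. z \<in> S \<Longrightarrow> norm z \<le> B" unfolding bounded_iff by blast
    show False using that(2)[of "B + 1"] B[of "f (B + 1)"] abs_Im_le_cmod[of "f (B + 1)"] by linarith
  qed
  show "\<not> bounded {z. Re z = x \<and> y \<le> Im z}"
  proof
    assume "bounded {z. Re z = x \<and> y \<le> Im z}"
    then show False
      by (rule *[where f = "\<lambda>t. Complex x (\<bar>y\<bar> + \<bar>t\<bar>)"]) auto
  qed
  show "\<not> bounded {z. Re z = x \<and> Im z \<le> y}"
  proof
    assume "bounded {z. Re z = x \<and> Im z \<le> y}"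
    then show False
      by (rule *[where f = "\<lambda>t. Complex x (- \<bar>y\<bar> - \<bar>t\<bar>)"]) auto
  qed
qed

lemma connected_vertical_rays:
  "connected {z. Re z = x \<and> y \<le> Im z}" "connected {z. Re z = x \<and> Im z \<le> y}"
proof -
  have "{z. Re z = x \<and> y \<le> Im z} = Complex x ` {y..}"
    "{z. Re z = x \<and> Im z \<le> y} = Complex x ` {..y}"
    by (auto simp: image_iff complex_eq_iff intro: bexI[of _ "Im _"])
  moreover have "continuous_on S (Complex x)" for S
    by (intro continuous_intros)
  ultimately show "connected {z. Re z = x \<and> y \<le> Im z}" "connected {z. Re z = x \<and> Im z \<le> y}"
    by (auto intro!: connected_continuous_image)
qed

section \<open>Connectivity, bridges and degrees in cycles\<close>

lemma joined_refl: "joined E u u"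
  by (simp add: joined_def)

lemma joined_trans: "joined E u v \<Longrightarrow> joined E v w \<Longrightarrow> joined E u w"
  by (simp add: joined_def)

lemma joined_sym: "joined E u v \<Longrightarrow> joined E v u"
  unfolding joined_def
  by (rule symD[OF sym_rtrancl]) (auto simp: sym_def insert_commute)

lemma joined_edge: "{u, v} \<in> E \<Longrightarrow> joined E u v"
  by (auto simp: joined_def)

lemma joined_mono: "joined E u v \<Longrightarrow> E \<subseteq> E' \<Longrightarrow> joined E' u v"
  unfolding joined_def by (erule rtrancl_mono[THEN subsetD, rotated]) auto

text \<open>\<open>is_bridge\<close> lets the two points range over the whole type. A walk of length
  zero survives trivially, even outside \<open>V\<close>, and every further step runs between points
  of \<open>V\<close>, which stay joined.\<close>

lemma not_bridge_if_connected:
  assumes "connected_graph V (E - {e})" "\<And>e. e \<in> E \<Longrightarrow> e \<subseteq> V"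
  shows "\<not> is_bridge E e"
proof -
  have "joined (E - {e}) u v" if "joined E u v" for u v
    using that unfolding joined_def[of E]
  proof (induction rule: rtrancl_induct)
    case base
    show ?case by (rule joined_refl)
  next
    case (step y z)
    then have "y \<in> V" "z \<in> V" using assms(2) by auto
    then show ?case using step assms(1) joined_trans by (metis connected_graph_def)
  qed
  then show ?thesis by (auto simp: is_bridge_def)
qed

text \<open>Each vertex of the cyclic sequence has an edge to its successor and one to its
  predecessor; having at least three vertices makes these edges different.\<close>

lemma cycle_no_leaf:
  assumes "is_cycle E C" "e \<in> C" "v \<in> e"
  obtains e' where "e' \<in> C" "e' \<noteq> e" "v \<in> e'"
proof -
  obtain vs where vs: "length vs \<ge> 3" "distinct vs"
    and C: "C = {{vs ! i, vs ! (Suc i mod length vs)} | i. i < length vs}"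
    using assms(1) by (auto simp: is_cycle_def)
  define L where "L = length vs"
  have L: "L \<ge> 3" using vs by (simp add: L_def)
  have nth_eq: "vs ! i = vs ! j \<longleftrightarrow> i = j" if "i < L" "j < L" for i j
    using that vs by (simp add: L_def nth_eq_iff_index_eq)
  have in_C: "{vs ! i, vs ! (Suc i mod L)} \<in> C" if "i < L" for i
    using that C by (auto simp: L_def)
  have *: "\<exists>e'\<in>C. e' \<noteq> {vs ! i, vs ! (Suc i mod L)} \<and> vs ! (Suc i mod L) \<in> e'"
    if i: "i < L" for i
  proof -
    define j where "j = Suc i mod L"
    define k where "k = Suc j mod L"
    have jk: "j < L" "k < L" using L by (auto simp: j_def k_def)
    have "k \<noteq> i" "k \<noteq> j" "i \<noteq> j"
      using L i by (auto simp: j_def k_def mod_Suc split: if_splits)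
    then have "{vs ! j, vs ! k} \<noteq> {vs ! i, vs ! j}"
      using nth_eq jk i by (auto simp: doubleton_eq_iff)
    moreover have "{vs ! j, vs ! k} \<in> C" using in_C[OF jk(1)] by (simp add: k_def)
    ultimately show ?thesis unfolding j_def[symmetric] by (intro bexI[of _ "{vs ! j, vs ! k}"]) auto
  qed
  obtain i where i: "i < L" and e: "e = {vs ! i, vs ! (Suc i mod L)}"
    using assms(2) C by (auto simp: L_def)
  consider "v = vs ! (Suc i mod L)" | "v = vs ! i" using assms(3) e by auto
  then show ?thesis
  proof cases
    case 1
    then show ?thesis using *[OF i] e that by blast
  next
    case 2
    \<comment> \<open>The cyclic predecessor of \<open>i\<close>, wrapping around at
      \<open>0\<close>.\<close>
    define j where "j = (if i = 0 then L - 1 else i - 1)"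
    have j: "j < L" "Suc j mod L = i" using i L by (auto simp: j_def)
    have "{vs ! j, vs ! i} \<noteq> e"
    proof
      assume "{vs ! j, vs ! i} = e"
      then have "vs ! j = vs ! (Suc i mod L)" by (auto simp: e doubleton_eq_iff)
      then have "j = Suc i mod L" using nth_eq j(1) L by auto
      then show False using L i by (auto simp: j_def mod_Suc split: if_splits)
    qed
    then show ?thesis using in_C[OF j(1)] j(2) 2 that by blast
  qed
qed

section \<open>The chain of lenses\<close>

datatype layer = Top | Mid | Bot

text \<open>\<open>Top\<close> vanishes exactly at the even integers, \<open>Bot\<close> exactly at \<open>0\<close> and \<open>2 n\<close>.\<close>

fun curve :: "nat \<Rightarrow> layer \<Rightarrow> real \<Rightarrow> real" where
  "curve n Top x = 1 - cos (pi * x)"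
| "curve n Mid x = 0"
| "curve n Bot x = x * (x - 2 * real n)"

declare curve.simps [simp del]

text \<open>\<open>(l, k)\<close> stands for the edge of layer \<open>l\<close> over
  \<open>[k, k + 1]\<close>. Counting is done on these indices rather than on edges as sets of
  points.\<close>

definition slots :: "nat \<Rightarrow> (layer \<times> nat) set" where
  "slots n = UNIV \<times> {..<2 * n}"

text \<open>Not an injective labelling: \<open>Top\<close> and \<open>Mid\<close> share their points
  at even abscissae, and all layers share those at \<open>0\<close> and \<open>2 * n\<close>. This
  glues the curves into one graph.\<close>

definition pt :: "nat \<Rightarrow> layer \<Rightarrow> nat \<Rightarrow> complex" where
  "pt n l k = Complex (real k) (curve n l (real k))"

definition edge :: "nat \<Rightarrow> layer \<times> nat \<Rightarrow> complex set" where
  "edge n = (\<lambda>(l, k). {pt n l k, pt n l (Suc k)})"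

definition verts :: "nat \<Rightarrow> complex set" where
  "verts n = (\<lambda>(l, k). pt n l k) ` (UNIV \<times> {..2 * n})"

definition edges :: "nat \<Rightarrow> complex set set" where
  "edges n = edge n ` slots n"

definition graph_path :: "(real \<Rightarrow> real) \<Rightarrow> real \<Rightarrow> real \<Rightarrow> complex" where
  "graph_path f a = (\<lambda>t. Complex (a + t) (f (a + t)))"

text \<open>A drawing assigns an arc to an edge, not to a slot, so the slot is recovered first;
  \<open>inj_on_edge\<close> makes this unambiguous.\<close>

definition arcs :: "nat \<Rightarrow> complex set \<Rightarrow> real \<Rightarrow> complex" where
  "arcs n e = (case inv_into (slots n) (edge n) e of (l, k) \<Rightarrow> graph_path (curve n l) (real k))"

definition layer_region :: "nat \<Rightarrow> layer \<Rightarrow> layer \<Rightarrow> nat \<Rightarrow> nat \<Rightarrow> complex set" where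
  "layer_region n lo hi a b = region (real a) (real b) (curve n lo) (curve n hi)"

definition lens :: "nat \<Rightarrow> nat \<Rightarrow> complex set" where
  "lens n i = layer_region n Mid Top (2 * i) (2 * i + 2)"

definition belly :: "nat \<Rightarrow> complex set" where
  "belly n = layer_region n Bot Mid 0 (2 * n)"

text \<open>For \<open>Mid\<close> and \<open>Top\<close>, \<open>k div 2\<close> is the index of
  the lens over \<open>[k, k + 1]\<close>.\<close>

definition route :: "nat \<Rightarrow> nat \<Rightarrow> (layer \<times> nat) set" where
  "route n j = {(l, k). k < 2 * n \<and> (l = Bot \<or> l = (if k div 2 = j then Mid else Top))}"

lemma UNIV_layer: "UNIV = {Top, Mid, Bot}"
  using layer.exhaust by auto

lemma continuous_on_curve: "continuous_on S (curve n l)"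
proof -
  have "continuous_on S (\<lambda>x. curve n l x)"
    by (cases l) (auto simp: curve.simps intro!: continuous_intros)
  then show ?thesis by simp
qed

section \<open>Signs and common points of the curves\<close>

lemma curve_Top_nonneg: "0 \<le> curve n Top x"
  by (simp add: curve.simps)

lemma curve_Top_eq_0: "curve n Top x = 0 \<longleftrightarrow> (\<exists>i::int. x = 2 * of_int i)"
  by (auto simp: curve.simps cos_one_2pi_int)

lemma curve_Bot_neg: "0 < x \<Longrightarrow> x < 2 * real n \<Longrightarrow> curve n Bot x < 0"
  by (simp add: curve.simps mult_pos_neg)

lemma curve_Bot_nonpos: "0 \<le> x \<Longrightarrow> x \<le> 2 * real n \<Longrightarrow> curve n Bot x \<le> 0"
  by (simp add: curve.simps mult_nonneg_nonpos)

text \<open>Over \<open>[0, 2 n]\<close> the zero curve \<open>Mid\<close> separates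
  \<open>Bot\<close> from \<open>Top\<close>, so different layers meet only where \<open>Top\<close>
  or \<open>Bot\<close> vanishes, in both cases at an even integer.\<close>

lemma curve_agree_imp_even:
  assumes "curve n l x = curve n l' x" "l \<noteq> l'" "0 \<le> x" "x \<le> 2 * real n"
  shows "\<exists>i::nat. x = 2 * real i"
proof -
  have "curve n Top x = 0 \<or> curve n Bot x = 0"
    using assms(1,2) curve_Top_nonneg[of n x] curve_Bot_nonpos[OF assms(3,4)]
    by (cases l; cases l') (auto simp: curve.simps(2))
  then show ?thesis
  proof
    assume "curve n Top x = 0"
    then obtain i :: int where "x = 2 * of_int i" by (auto simp: curve_Top_eq_0)
    then show ?thesis using assms(3) by (intro exI[of _ "nat i"]) auto
  next
    assume "curve n Bot x = 0"
    then have "x = 2 * real 0 \<or> x = 2 * real n" by (simp add: curve.simps)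
    then show ?thesis by blast
  qed
qed

lemma curve_agree_nat_imp_even:
  assumes "curve n l (real k) = curve n l' (real k)" "l \<noteq> l'" "k \<le> 2 * n"
  shows "even k"
proof -
  have "real k \<le> 2 * real n"
    using assms(3) by linarith
  then obtain i where "real k = real (2 * i)"
    using curve_agree_imp_even[OF assms(1,2)] by auto
  then show ?thesis by (metis dvd_triv_left of_nat_eq_iff)
qed

lemma pt_eq_iff: "pt n l k = pt n l' k' \<longleftrightarrow> k = k' \<and> curve n l (real k) = curve n l' (real k)"
  by (auto simp: pt_def)

lemma edgesE:
  assumes "e \<in> edges n"
  obtains l k where "(l, k) \<in> slots n" "e = edge n (l, k)"
  using assms unfolding edges_def by (metis imageE prod.exhaust)

text \<open>One of the two end abscissae is odd, and there the layers are apart. This is why each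
  side of a lens carries two edges: with a single one, both sides would be the same pair of
  vertices.\<close>

lemma inj_on_edge: "inj_on (edge n) (slots n)"
proof (rule inj_onI, clarify)
  fix l k l' k' assume "(l, k) \<in> slots n" "(l', k') \<in> slots n"
    and eq: "edge n (l, k) = edge n (l', k')"
  then have k: "Suc k \<le> 2 * n" by (auto simp: slots_def)
  have "k = k'" and agree: "curve n l (real k) = curve n l' (real k)"
      "curve n l (real (Suc k)) = curve n l' (real (Suc k))"
    using eq by (auto simp: edge_def doubleton_eq_iff pt_eq_iff simp del: of_nat_Suc)
  moreover have "l = l'"
  proof (rule ccontr)
    assume "l \<noteq> l'"
    then have "even k" "even (Suc k)"
      using agree k by (auto dest!: curve_agree_nat_imp_even simp del: of_nat_Suc)
    then show False by simp
  qed
  ultimately show "l = l' \<and> k = k'" by simp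
qed

lemma arcs_edge: "x \<in> slots n \<Longrightarrow> arcs n (edge n x) = graph_path (curve n (fst x)) (real (snd x))"
  by (simp add: arcs_def inv_into_f_f inj_on_edge case_prod_beta)

section \<open>The drawing as a plane graph\<close>

lemma path_image_graph_path:
  "path_image (graph_path f a) = {z. a \<le> Re z \<and> Re z \<le> a + 1 \<and> Im z = f (Re z)}"
proof (intro equalityI subsetI)
  fix z assume "z \<in> {z. a \<le> Re z \<and> Re z \<le> a + 1 \<and> Im z = f (Re z)}"
  then have "Re z - a \<in> {0..1}" "z = graph_path f a (Re z - a)"
    by (auto simp: graph_path_def complex_eq_iff)
  then show "z \<in> path_image (graph_path f a)"
    unfolding path_image_def by blast
qed (auto simp: path_image_def graph_path_def)

lemma arc_graph_path:
  assumes "continuous_on UNIV f"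
  shows "arc (graph_path f a)"
proof -
  have "continuous_on {0..1} (\<lambda>t. f (a + t))"
    by (intro continuous_on_compose2[OF assms] continuous_intros subset_UNIV)
  then have "continuous_on {0..1} (graph_path f a)"
    unfolding graph_path_def by (intro continuous_intros)
  then show ?thesis
    by (auto simp: arc_def path_def graph_path_def intro!: inj_onI)
qed

lemma path_image_arcs:
  assumes "(l, k) \<in> slots n"
  shows "path_image (arcs n (edge n (l, k))) =
    {z. real k \<le> Re z \<and> Re z \<le> real k + 1 \<and> Im z = curve n l (Re z)}"
  using assms by (simp add: arcs_edge path_image_graph_path)

lemma pt_in_edge: "pt n l k \<in> edge n (l, k)" "pt n l (Suc k) \<in> edge n (l, k)"
  by (simp_all add: edge_def)

lemma edge_subset_verts: "x \<in> slots n \<Longrightarrow> edge n x \<subseteq> verts n"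
  by (force simp: edge_def verts_def slots_def)

lemma nat_in_unit_interval: "real k \<le> real m \<Longrightarrow> real m \<le> real k + 1 \<Longrightarrow> m = k \<or> m = Suc k"
  by linarith

lemma plane_graph_edges: "plane_graph (verts n) (edges n) (arcs n)"
proof -
  have "simple_graph (verts n) (edges n)"
    unfolding simple_graph_def
  proof (intro conjI ballI)
    show "finite (verts n)" by (simp add: verts_def UNIV_layer)
    fix e assume "e \<in> edges n"
    then show "e \<subseteq> verts n" "card e = 2"
      using edge_subset_verts by (auto simp: edges_def edge_def pt_eq_iff)
  qed
  moreover have "arc (arcs n e) \<and> {pathstart (arcs n e), pathfinish (arcs n e)} = e \<and>
      path_image (arcs n e) \<inter> verts n = e" if mem: "e \<in> edges n" for e
  proof -
    obtain l k where lk: "(l, k) \<in> slots n" and e: "e = edge n (l, k)"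
      using mem by (rule edgesE)
    have arcs: "arcs n e = graph_path (curve n l) (real k)" using lk by (simp add: e arcs_edge)
    have "e \<subseteq> path_image (arcs n e)"
      unfolding e path_image_arcs[OF lk] by (auto simp: edge_def pt_def add.commute)
    moreover have "z \<in> e" if "z \<in> path_image (arcs n e)" and vert: "z \<in> verts n" for z
    proof -
      obtain l' m where z: "z = pt n l' m" using vert by (auto simp: verts_def)
      have m: "real k \<le> real m" "real m \<le> real k + 1" "z = pt n l m"
        using that(1) lk by (auto simp: e path_image_arcs z pt_def)
      then show ?thesis using nat_in_unit_interval[of k m] by (auto simp: e pt_in_edge)
    qed
    ultimately have "path_image (arcs n e) \<inter> verts n = e"
      using edge_subset_verts[OF lk] e by blast
    moreover have "{pathstart (arcs n e), pathfinish (arcs n e)} = e"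
      unfolding arcs by (simp add: graph_path_def pathstart_def pathfinish_def e edge_def pt_def add.commute)
    ultimately show ?thesis
      by (simp add: arcs arc_graph_path continuous_on_curve)
  qed
  moreover have "path_image (arcs n e) \<inter> path_image (arcs n e') \<subseteq> e \<inter> e'"
    if mem: "e \<in> edges n" "e' \<in> edges n" and "e \<noteq> e'" for e e'
  proof
    fix z assume z: "z \<in> path_image (arcs n e) \<inter> path_image (arcs n e')"
    obtain l k where lk: "(l, k) \<in> slots n" and e: "e = edge n (l, k)"
      using mem(1) by (rule edgesE)
    obtain l' k' where lk': "(l', k') \<in> slots n" and e': "e' = edge n (l', k')"
      using mem(2) by (rule edgesE)
    have bd: "real k \<le> Re z" "Re z \<le> real k + 1" "real k' \<le> Re z" "Re z \<le> real k' + 1"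
      and Im: "Im z = curve n l (Re z)" "Im z = curve n l' (Re z)"
      using z lk lk' by (auto simp: e e' path_image_arcs)
    have "real k + 1 \<le> 2 * real n"
      using lk by (auto simp: slots_def)
    then have le: "0 \<le> Re z" "Re z \<le> 2 * real n" using bd by linarith+
    \<comment> \<open>Arcs of one layer overlap only at an end of their unit intervals; arcs of
      different layers meet only at even abscissae. Either way the common point is a vertex.\<close>
    have "\<exists>m. Re z = real m"
    proof (cases "l = l'")
      case True
      then have "k < k' \<or> k' < k" using that(3) e e' by (cases k k' rule: linorder_cases) auto
      then have "Re z = real k \<or> Re z = real k'" using bd by auto
      then show ?thesis by blast
    next
      case False
      then obtain i where "Re z = 2 * real i"
        using curve_agree_imp_even[of n l "Re z" l'] Im le by auto
      then show ?thesis by (intro exI[of _ "2 * i"]) simp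
    qed
    then obtain m where m: "Re z = real m" by blast
    then have "z = pt n l m" "z = pt n l' m"
      using Im by (auto simp: pt_def complex_eq_iff)
    moreover have "m = k \<or> m = Suc k" "m = k' \<or> m = Suc k'"
      using bd m nat_in_unit_interval by auto
    ultimately show "z \<in> e \<inter> e'" by (auto simp: e e' edge_def)
  qed
  ultimately show ?thesis by (auto simp: plane_graph_def)
qed

lemma drawing_eq:
  assumes "n > 0"
  shows "drawing (verts n) (edges n) (arcs n) =
    {z. 0 \<le> Re z \<and> Re z \<le> 2 * real n \<and> (\<exists>l. Im z = curve n l (Re z))}" (is "_ = ?D")
proof (intro equalityI subsetI)
  fix z assume "z \<in> drawing (verts n) (edges n) (arcs n)"
  then consider "z \<in> verts n" | l k where "(l, k) \<in> slots n" "z \<in> path_image (arcs n (edge n (l, k)))"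
    by (auto simp: drawing_def edges_def)
  then show "z \<in> ?D"
  proof cases
    case 1
    then obtain l k where "k \<le> 2 * n" "z = pt n l k" by (auto simp: verts_def)
    then show ?thesis by (auto simp: pt_def)
  next
    case 2
    then have "k < 2 * n" by (simp add: slots_def)
    then have "real k + 1 \<le> 2 * real n" by simp
    then show ?thesis using 2 by (auto simp: path_image_arcs)
  qed
next
  fix z assume z: "z \<in> ?D"
  then obtain l where l: "Im z = curve n l (Re z)" by auto
  \<comment> \<open>The minimum assigns the right end \<open>2 n\<close> to the last slot, where the
    floor alone would leave the range.\<close>
  define k where "k = min (nat \<lfloor>Re z\<rfloor>) (2 * n - 1)"
  have lk: "(l, k) \<in> slots n" using assms by (auto simp: slots_def k_def)
  have "real k \<le> Re z" "Re z \<le> real k + 1"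
    using z assms by (auto simp: k_def min_def of_nat_diff) linarith+
  then have "z \<in> path_image (arcs n (edge n (l, k)))" using lk l by (simp add: path_image_arcs)
  then show "z \<in> drawing (verts n) (edges n) (arcs n)"
    using lk by (auto simp: drawing_def edges_def)
qed


section \<open>The bounded faces\<close>

lemma curve_strict:
  shows "real (2 * i) < x \<Longrightarrow> x < real (2 * i + 2) \<Longrightarrow> curve n Mid x < curve n Top x"
    and "0 < x \<Longrightarrow> x < real (2 * n) \<Longrightarrow> curve n Bot x < curve n Mid x"
proof -
  assume x: "real (2 * i) < x" "x < real (2 * i + 2)"
  have "curve n Top x \<noteq> 0"
  proof
    assume "curve n Top x = 0"
    then obtain m :: int where m: "x = 2 * of_int m" by (auto simp: curve_Top_eq_0)
    then have "of_int (int i) < (of_int m :: real)" "of_int m < (of_int (int i + 1) :: real)"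
      using x by auto
    then have "int i < m" "m < int i + 1" by (simp_all only: of_int_less_iff)
    then show False by simp
  qed
  then show "curve n Mid x < curve n Top x"
    using curve_Top_nonneg[of n x] by (simp add: curve.simps(2))
next
  assume "0 < x" "x < real (2 * n)"
  then show "curve n Bot x < curve n Mid x"
    using curve_Bot_neg[of x n] by (simp add: curve.simps(2))
qed

text \<open>Treats lenses and belly at once. The two sides meet over \<open>a\<close> and
  \<open>b\<close>, so the frontier has no vertical pieces and lies in the drawing, while
  \<open>free\<close> keeps the drawing out of the interior; hence the region is a
  component.\<close>

lemma layer_region_facts:
  assumes "n > 0" "a < b" "b \<le> 2 * n"
    and less: "\<And>x. real a < x \<Longrightarrow> x < real b \<Longrightarrow> curve n lo x < curve n hi x"
    and ends: "curve n lo (real a) = curve n hi (real a)" "curve n lo (real b) = curve n hi (real b)"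
    and free: "\<And>x l. real a < x \<Longrightarrow> x < real b \<Longrightarrow>
      \<not> (curve n lo x < curve n l x \<and> curve n l x < curve n hi x)"
  shows "layer_region n lo hi a b \<in> finite_faces (verts n) (edges n) (arcs n)"
    and "face_edges (edges n) (arcs n) (layer_region n lo hi a b) = edge n ` ({lo, hi} \<times> {a..<b})"
proof -
  let ?R = "layer_region n lo hi a b"
  have ab: "real a < real b" using assms(2) by simp
  have le: "curve n lo (real a) \<le> curve n hi (real a)" "curve n lo (real b) \<le> curve n hi (real b)"
    using ends by auto
  note facts = ab continuous_on_curve continuous_on_curve less le
  have frontier: "frontier ?R =
      closed_region (real a) (real b) (curve n lo) (curve n hi) - ?R"
    unfolding layer_region_def by (rule frontier_region) (fact facts)+
  have "real b \<le> 2 * real n" using assms(3) by linarith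
  then have avoid: "?R \<subseteq> - drawing (verts n) (edges n) (arcs n)"
    using free unfolding drawing_eq[OF assms(1)]
    by (fastforce simp: layer_region_def region_def)
  have on: "z \<in> drawing (verts n) (edges n) (arcs n)" if "z \<in> frontier ?R" for z
  proof -
    have z: "real a \<le> Re z" "Re z \<le> real b"
        "curve n lo (Re z) \<le> Im z" "Im z \<le> curve n hi (Re z)" and "z \<notin> ?R"
      using that by (auto simp: frontier closed_region_def)
    then have "Im z = curve n lo (Re z) \<or> Im z = curve n hi (Re z)"
      using ends by (cases "Re z = real a"; cases "Re z = real b")
        (auto simp: layer_region_def region_def)
    then show ?thesis
      using z \<open>real b \<le> 2 * real n\<close> unfolding drawing_eq[OF assms(1)] by auto
  qed
  have "?R \<in> components (- drawing (verts n) (edges n) (arcs n))"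
  proof (rule component_if_frontier_disjoint)
    show "connected ?R"
      unfolding layer_region_def by (rule connected_region) (fact facts)+
    show "?R \<noteq> {}"
      unfolding layer_region_def by (rule region_nonempty) (fact facts)+
  qed (use avoid on in auto)
  moreover have "bounded ?R"
    unfolding layer_region_def by (rule bounded_region) (fact facts)+
  ultimately show "?R \<in> finite_faces (verts n) (edges n) (arcs n)"
    by (simp add: finite_faces_def faces_def)
  have "path_image (arcs n (edge n (l, k))) \<subseteq> frontier ?R \<longleftrightarrow> l \<in> {lo, hi} \<and> a \<le> k \<and> k < b"
    if lk: "(l, k) \<in> slots n" for l k
  proof
    assume sub: "path_image (arcs n (edge n (l, k))) \<subseteq> frontier ?R"
    define x where "x = real k + 1 / 2"
    \<comment> \<open>At a point off the integers the three curves are distinct.\<close>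
    have "Complex x (curve n l x) \<in> frontier ?R"
      using sub lk by (auto simp: path_image_arcs x_def)
    then have x: "real a \<le> x" "x \<le> real b"
        and between: "curve n lo x \<le> curve n l x" "curve n l x \<le> curve n hi x"
        and "Complex x (curve n l x) \<notin> ?R"
      by (auto simp: frontier closed_region_def)
    have kab: "a \<le> k" "k < b" using x unfolding x_def by linarith+
    then have strict: "real a < x" "x < real b" unfolding x_def by linarith+
    then have "curve n l x = curve n lo x \<or> curve n l x = curve n hi x"
      using between \<open>Complex x (curve n l x) \<notin> ?R\<close> by (auto simp: layer_region_def region_def)
    moreover have "l = l'" if eq: "curve n l x = curve n l' x" for l'
    proof (rule ccontr)
      assume "l \<noteq> l'"
      then obtain i :: nat where "x = 2 * real i"
        using curve_agree_imp_even[OF eq] strict \<open>real b \<le> 2 * real n\<close> by auto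
      then have "real (2 * k + 1) = real (4 * i)" by (simp add: x_def)
      then have "2 * k + 1 = 4 * i" by (simp only: of_nat_eq_iff)
      then show False by presburger
    qed
    ultimately show "l \<in> {lo, hi} \<and> a \<le> k \<and> k < b" using kab by blast
  next
    assume *: "l \<in> {lo, hi} \<and> a \<le> k \<and> k < b"
    show "path_image (arcs n (edge n (l, k))) \<subseteq> frontier ?R"
    proof
      fix z assume "z \<in> path_image (arcs n (edge n (l, k)))"
      then have z: "real k \<le> Re z" "Re z \<le> real k + 1" "Im z = curve n l (Re z)"
        using lk by (auto simp: path_image_arcs)
      have bd: "real a \<le> Re z" "Re z \<le> real b" using z * by linarith+
      then have "curve n lo (Re z) \<le> curve n hi (Re z)"
        using less[of "Re z"] le by (cases "Re z = real a"; cases "Re z = real b") auto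
      then have "z \<in> closed_region (real a) (real b) (curve n lo) (curve n hi)" "z \<notin> ?R"
        using z * bd by (auto simp: closed_region_def layer_region_def region_def)
      then show "z \<in> frontier ?R" by (simp add: frontier)
    qed
  qed
  note path_image_iff = this
  have "(l, k) \<in> slots n \<and> path_image (arcs n (edge n (l, k))) \<subseteq> frontier ?R \<longleftrightarrow>
      (l, k) \<in> {lo, hi} \<times> {a..<b}" for l k
  proof -
    have "(l, k) \<in> slots n" if "k < b" using that assms(3) by (simp add: slots_def)
    then show ?thesis using path_image_iff[of l k] by auto
  qed
  then have "{x \<in> slots n. path_image (arcs n (edge n x)) \<subseteq> frontier ?R} = {lo, hi} \<times> {a..<b}"
    by (intro set_eqI) (simp only: split_paired_all mem_Collect_eq)
  moreover have "face_edges (edges n) (arcs n) ?R =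
      edge n ` {x \<in> slots n. path_image (arcs n (edge n x)) \<subseteq> frontier ?R}"
    unfolding face_edges_def edges_def by blast
  ultimately show "face_edges (edges n) (arcs n) ?R = edge n ` ({lo, hi} \<times> {a..<b})"
    by simp
qed

lemma curve_ends:
  "curve n Mid (real (2 * i)) = curve n Top (real (2 * i))"
  "curve n Bot 0 = curve n Mid 0" "curve n Bot (real (2 * n)) = curve n Mid (real (2 * n))"
proof -
  have "curve n Top (real (2 * i)) = 0"
    by (subst curve_Top_eq_0) (auto intro: exI[of _ "int i"])
  then show "curve n Mid (real (2 * i)) = curve n Top (real (2 * i))"
    by (simp add: curve.simps(2))
qed (simp_all add: curve.simps)

lemma lens_face:
  assumes "i < n"
  shows "lens n i \<in> finite_faces (verts n) (edges n) (arcs n)"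
    and "face_edges (edges n) (arcs n) (lens n i) = edge n ` ({Mid, Top} \<times> {2 * i..<2 * i + 2})"
proof -
  have *: "\<not> (curve n Mid x < curve n l x \<and> curve n l x < curve n Top x)"
    if "real (2 * i) < x" "x < real (2 * i + 2)" for x l
  proof -
    have "0 \<le> x" "x \<le> 2 * real n" using that assms by auto
    then show ?thesis
      using curve_Bot_nonpos[of x n] by (cases l) (auto simp: curve.simps(2))
  qed
  have "curve n Mid (real (2 * i + 2)) = curve n Top (real (2 * i + 2))"
    using curve_ends(1)[of n "i + 1"] by (simp add: algebra_simps)
  then show "lens n i \<in> finite_faces (verts n) (edges n) (arcs n)"
    "face_edges (edges n) (arcs n) (lens n i) = edge n ` ({Mid, Top} \<times> {2 * i..<2 * i + 2})"
    unfolding lens_def using assms curve_strict(1)[of i _ n] curve_ends(1)[of n i] *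
    by (intro layer_region_facts; simp)+
qed

lemma belly_face:
  assumes "n > 0"
  shows "belly n \<in> finite_faces (verts n) (edges n) (arcs n)"
    and "face_edges (edges n) (arcs n) (belly n) = edge n ` ({Bot, Mid} \<times> {0..<2 * n})"
proof -
  have *: "\<not> (curve n Bot x < curve n l x \<and> curve n l x < curve n Mid x)" for x l
    using curve_Top_nonneg[of n x] by (cases l) (auto simp: curve.simps(2))
  show "belly n \<in> finite_faces (verts n) (edges n) (arcs n)"
    "face_edges (edges n) (arcs n) (belly n) = edge n ` ({Bot, Mid} \<times> {0..<2 * n})"
    unfolding belly_def using assms curve_strict(2)[of _ n] curve_ends(2,3)[of n] *
    by (intro layer_region_facts; simp)+
qed

text \<open>A bounded face contains no vertical ray, so the drawing has points above and below each
  point of the face. Such a point lies strictly between \<open>Bot\<close> and \<open>Top\<close>,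
  and the sign of its imaginary part places it in the belly or in a lens; components sharing a point
  are equal.\<close>

lemma finite_faces_eq:
  assumes "n > 0"
  shows "finite_faces (verts n) (edges n) (arcs n) = insert (belly n) (lens n ` {..<n})"
    (is "?L = ?R")
proof
  show "?R \<subseteq> ?L" using belly_face(1)[OF assms] lens_face(1) by auto
  show "?L \<subseteq> ?R"
  proof
    fix F assume F: "F \<in> ?L"
    let ?U = "- drawing (verts n) (edges n) (arcs n)"
    have comp: "F \<in> components ?U" and "bounded F"
      using F by (auto simp: finite_faces_def faces_def)
    then obtain z where z: "z \<in> F" "z \<in> ?U"
      using in_components_nonempty in_components_subset by blast
    have no_ray: False if "connected S" "S \<subseteq> ?U" "z \<in> S" "\<not> bounded S" for S
    proof -
      have "S \<subseteq> F" using components_maximal[OF comp that(1,2)] that(3) z(1) by blast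
      then show False using \<open>bounded F\<close> that(4) bounded_subset by blast
    qed
    have same: "F = G" if "G \<in> ?L" "z \<in> G" for G
      using that comp z(1) components_eq[OF comp, of G] by (auto simp: finite_faces_def faces_def)
    have U: "?U = {z. \<not> (0 \<le> Re z \<and> Re z \<le> 2 * real n \<and> (\<exists>l. Im z = curve n l (Re z)))}"
      by (auto simp: drawing_eq[OF assms])
    have "\<exists>w\<in>{z. Re z = x \<and> y \<le> Im z}. w \<notin> ?U" if "x = Re z" "y = Im z" for x y
      using no_ray[OF connected_vertical_rays(1) _ _ unbounded_vertical_rays(1), of x y] that
      by auto
    then have x: "0 \<le> Re z" "Re z \<le> 2 * real n" and above: "\<exists>l. Im z \<le> curve n l (Re z)"
      unfolding U by fastforce+
    have "\<exists>w\<in>{z. Re z = x \<and> Im z \<le> y}. w \<notin> ?U" if "x = Re z" "y = Im z" for x y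
      using no_ray[OF connected_vertical_rays(2) _ _ unbounded_vertical_rays(2), of x y] that
      by auto
    then have below: "\<exists>l. curve n l (Re z) \<le> Im z"
      unfolding U by fastforce
    have off: "Im z \<noteq> curve n l (Re z)" for l using z(2) x unfolding U by auto
    have Mid0: "curve n Mid (Re z) = 0" by (simp add: curve.simps)
    have ord: "curve n Bot (Re z) \<le> 0" "0 \<le> curve n Top (Re z)"
      using curve_Bot_nonpos x curve_Top_nonneg by auto
    have "curve n l (Re z) \<le> curve n Top (Re z)" "curve n Bot (Re z) \<le> curve n l (Re z)" for l
      using Mid0 ord by (cases l; simp)+
    then have lt: "Im z < curve n Top (Re z)" "curve n Bot (Re z) < Im z"
      using above below off order.trans by (metis order.not_eq_order_implies_strict)+
    show "F \<in> ?R"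
    proof (cases "Im z < 0")
      case True
      \<comment> \<open>\<open>Bot\<close> vanishes over \<open>0\<close> and \<open>2 n\<close>, so
        these abscissae are excluded and the bounds on \<open>Re z\<close> become strict.\<close>
      then have "curve n Bot (Re z) \<noteq> 0" using lt by auto
      then have "Re z \<noteq> 0" "Re z \<noteq> 2 * real n" by (auto simp: curve.simps)
      then have "z \<in> belly n"
        using x lt True Mid0 by (auto simp: belly_def layer_region_def region_def)
      then show ?thesis using same belly_face(1)[OF assms] by blast
    next
      case False
      then have pos: "0 < Im z" using off[of Mid] Mid0 by linarith
      then have "curve n Top (Re z) \<noteq> 0" using lt by auto
      then have *: "Re z \<noteq> 2 * of_int i" for i :: int by (auto simp: curve_Top_eq_0)
      \<comment> \<open>The lens over \<open>Re z\<close>. As \<open>Top\<close> does not vanish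
        there, \<open>Re z\<close> is no even integer; this makes the left bound strict and excludes
        \<open>2 n\<close>, so that \<open>i < n\<close>.\<close>
      define i where "i = nat \<lfloor>Re z / 2\<rfloor>"
      have i: "real i \<le> Re z / 2" "Re z / 2 < real i + 1"
        using x unfolding i_def by (simp_all add: of_nat_nat) linarith+
      have "Re z \<noteq> 2 * real i" "Re z \<noteq> 2 * real n" using *[of "int i"] *[of "int n"] by auto
      then have "z \<in> lens n i" "i < n"
        using i x lt pos Mid0 by (auto simp: lens_def layer_region_def region_def)
      then show ?thesis using same lens_face(1) by blast
    qed
  qed
qed

text \<open>Since \<open>edge n\<close> is injective on slots, edges of a face that belong to a
  cycle can be counted as slots; comparing signatures then amounts to one count per lens and one for
  the belly.\<close>

lemma signature_eq_iff:
  assumes "n > 0" "A \<subseteq> slots n" "B \<subseteq> slots n"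
  shows "signature (verts n) (edges n) (arcs n) (edge n ` A) =
      signature (verts n) (edges n) (arcs n) (edge n ` B) \<longleftrightarrow>
    (\<forall>i<n. card (({Mid, Top} \<times> {2 * i..<2 * i + 2}) \<inter> A) =
           card (({Mid, Top} \<times> {2 * i..<2 * i + 2}) \<inter> B)) \<and>
    card (({Bot, Mid} \<times> {0..<2 * n}) \<inter> A) = card (({Bot, Mid} \<times> {0..<2 * n}) \<inter> B)"
proof -
  have card: "card (edge n ` X \<inter> edge n ` Y) = card (X \<inter> Y)" if "X \<subseteq> slots n" "Y \<subseteq> slots n" for X Y
  proof -
    have "edge n ` X \<inter> edge n ` Y = edge n ` (X \<inter> Y)"
      using inj_on_image_Int[OF inj_on_edge that] by simp
    moreover have "inj_on (edge n) (X \<inter> Y)"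
      using inj_on_edge that by (meson inf.coboundedI1 inj_on_subset)
    ultimately show ?thesis by (simp add: card_image)
  qed
  have sub: "{Mid, Top} \<times> {2 * i..<2 * i + 2} \<subseteq> slots n" if "i < n" for i
    using that by (auto simp: slots_def)
  have sub': "{Bot, Mid} \<times> {0..<2 * n} \<subseteq> slots n" by (auto simp: slots_def)
  have "signature (verts n) (edges n) (arcs n) (edge n ` A) =
      signature (verts n) (edges n) (arcs n) (edge n ` B) \<longleftrightarrow>
    (\<forall>F\<in>insert (belly n) (lens n ` {..<n}). card (face_edges (edges n) (arcs n) F \<inter> edge n ` A) =
      card (face_edges (edges n) (arcs n) F \<inter> edge n ` B))"
    unfolding signature_def finite_faces_eq[OF assms(1)] restrict_def fun_eq_iff by metis
  also have "\<dots> \<longleftrightarrow> card (edge n ` ({Bot, Mid} \<times> {0..<2 * n}) \<inter> edge n ` A) =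
        card (edge n ` ({Bot, Mid} \<times> {0..<2 * n}) \<inter> edge n ` B) \<and>
      (\<forall>i<n. card (edge n ` ({Mid, Top} \<times> {2 * i..<2 * i + 2}) \<inter> edge n ` A) =
        card (edge n ` ({Mid, Top} \<times> {2 * i..<2 * i + 2}) \<inter> edge n ` B))"
    using belly_face(2)[OF assms(1)] lens_face(2) by auto
  also have "\<dots> \<longleftrightarrow> (\<forall>i<n. card (({Mid, Top} \<times> {2 * i..<2 * i + 2}) \<inter> A) =
           card (({Mid, Top} \<times> {2 * i..<2 * i + 2}) \<inter> B)) \<and>
    card (({Bot, Mid} \<times> {0..<2 * n}) \<inter> A) = card (({Bot, Mid} \<times> {0..<2 * n}) \<inter> B)"
    using card[OF sub assms(2)] card[OF sub assms(3)] card[OF sub' assms(2)] card[OF sub' assms(3)]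
    by auto
  finally show ?thesis .
qed


section \<open>The cycles\<close>

lemma joined_along_layer:
  assumes "\<And>k. a \<le> k \<Longrightarrow> k < b \<Longrightarrow> edge n (l, k) \<in> E" "a \<le> b"
  shows "joined E (pt n l a) (pt n l b)"
  using assms(2,1)
proof (induction b rule: dec_induct)
  case base
  show ?case by (rule joined_refl)
next
  case (step k)
  then have "joined E (pt n l a) (pt n l k)" "edge n (l, k) \<in> E" by auto
  then show ?case using joined_trans joined_edge unfolding edge_def by (metis case_prod_conv)
qed

lemma pt_ends: "pt n l 0 = pt n l' 0" "pt n l (2 * n) = pt n l' (2 * n)"
  using curve_ends(1)[of n 0] curve_ends(1)[of n n] curve_ends(2,3)[of n]
  by (cases l; cases l'; simp add: pt_eq_iff)+

text \<open>The layers are three walks with common ends, and deleting an edge interrupts at most one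
  of them. Each of its vertices is still reachable from the left or from the right end.\<close>

lemma connected_delete_edge: "connected_graph (verts n) (edges n - {e})"
proof -
  let ?E = "edges n - {e}"
  have origin: "joined ?E (pt n Mid 0) (pt n l k)" if k: "k \<le> 2 * n" for l k
  proof (cases "\<exists>m<2 * n. e = edge n (l, m)")
    case False
    then have "edge n (l, m) \<in> ?E" if "m < k" for m
    proof -
      have "m < 2 * n" using that k by simp
      then show ?thesis using False by (auto simp: edges_def slots_def)
    qed
    then have "joined ?E (pt n l 0) (pt n l k)"
      by (intro joined_along_layer) auto
    then show ?thesis using pt_ends(1) by metis
  next
    case True
    then obtain m where m: "m < 2 * n" "e = edge n (l, m)" by blast
    have keep: "edge n (l', m') \<in> ?E" if "(l', m') \<noteq> (l, m)" "m' < 2 * n" for l' m'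
    proof -
      have "(l', m') \<in> slots n" "(l, m) \<in> slots n" using that m by (simp_all add: slots_def)
      then have "edge n (l', m') \<noteq> e" using inj_on_edge that(1) m(2) by (metis inj_on_eq_iff)
      then show ?thesis using \<open>(l', m') \<in> slots n\<close> by (simp add: edges_def)
    qed
    show ?thesis
    proof (cases "k \<le> m")
      case True
      then have "joined ?E (pt n l 0) (pt n l k)"
        using m True by (intro joined_along_layer keep) auto
      then show ?thesis using pt_ends(1) by metis
    next
      case False
      \<comment> \<open>Beyond the gap: an intact layer leads to the right end, from where
        \<open>l\<close> is followed backwards.\<close>
      obtain l' where l': "l' \<noteq> l" by (metis layer.distinct(1))
      have "joined ?E (pt n l' 0) (pt n l' (2 * n))"
        using l' by (intro joined_along_layer keep) auto
      moreover have "joined ?E (pt n l k) (pt n l (2 * n))"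
        using k False by (intro joined_along_layer keep) auto
      ultimately show ?thesis using pt_ends joined_trans joined_sym by metis
    qed
  qed
  have from_origin: "joined ?E (pt n Mid 0) v" if "v \<in> verts n" for v
    using that origin by (auto simp: verts_def)
  have "joined ?E u v" if "u \<in> verts n" "v \<in> verts n" for u v
    by (rule joined_trans[OF joined_sym]) (rule from_origin that)+
  moreover have "verts n \<noteq> {}" by (auto simp: verts_def)
  ultimately show ?thesis by (simp add: connected_graph_def)
qed

text \<open>Instance of the deletion lemma with \<open>{}\<close>, which is not an edge.\<close>

lemma connected_graph_edges: "connected_graph (verts n) (edges n)"
  using connected_delete_edge[of n "{}"]
  unfolding connected_graph_def by (auto dest: joined_mono[OF _ Diff_subset])

lemma bridgeless_edges: "bridgeless (edges n)"
  unfolding bridgeless_def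
  using not_bridge_if_connected[OF connected_delete_edge] edge_subset_verts
  by (metis edgesE)

section \<open>The routes as cycles\<close>

lemma route_subset_slots: "route n j \<subseteq> slots n"
  by (auto simp: route_def slots_def)

lemma curve_Mid_eq_Top_if_even: "even k \<Longrightarrow> curve n Mid (real k) = curve n Top (real k)"
  using curve_ends(1) by (auto elim!: evenE)

lemma is_cycle_route:
  assumes "n > 0"
  shows "is_cycle (edges n) (edge n ` route n j)"
proof -
  define lev where "lev k = (if k div 2 = j then Mid else Top)" for k :: nat
  \<comment> \<open>Indices up to \<open>2 n\<close> run to the right above; the others return along
    \<open>Bot\<close> at abscissa \<open>4 n - i\<close>. At \<open>2 n\<close> every layer gives
    the same point.\<close>
  define f where "f i = (if i \<le> 2 * n then pt n (lev i) i else pt n Bot (4 * n - i))" for i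
  define vs where "vs = map f [0..<4 * n]"
  have len: "length vs = 4 * n" by (simp add: vs_def)
  \<comment> \<open>The layer can change only at even abscissae, where \<open>Top\<close> and
    \<open>Mid\<close> share a point.\<close>
  have lev_next: "pt n (lev (Suc k)) (Suc k) = pt n (lev k) (Suc k)" for k
  proof (cases "even k")
    case True
    then show ?thesis by (simp add: lev_def)
  next
    case False
    then show ?thesis using curve_Mid_eq_Top_if_even[of "Suc k" n] by (auto simp: lev_def pt_eq_iff)
  qed
  \<comment> \<open>For distinctness: the sign of the imaginary part tells the way out from the way
    back, and on each of them the real part determines the index.\<close>
  have lower: "Im (f i) < 0 \<longleftrightarrow> 2 * n < i" "Re (f i) = (if i \<le> 2 * n then real i else real (4 * n - i))"
    if "i < 4 * n" for i
  proof -
    have "0 \<le> curve n (lev i) (real i)"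
      using curve_Top_nonneg[of n "real i"] by (simp add: lev_def curve.simps(2))
    moreover have "curve n Bot (real (4 * n - i)) < 0" if "2 * n < i"
    proof (rule curve_Bot_neg)
      show "0 < real (4 * n - i)" using \<open>i < 4 * n\<close> by simp
      have "4 * n - i < 2 * n" using that \<open>i < 4 * n\<close> by linarith
      then show "real (4 * n - i) < 2 * real n" by linarith
    qed
    ultimately show "Im (f i) < 0 \<longleftrightarrow> 2 * n < i"
      by (cases "i \<le> 2 * n") (simp_all add: f_def pt_def)
    show "Re (f i) = (if i \<le> 2 * n then real i else real (4 * n - i))"
      by (simp add: f_def pt_def)
  qed
  have "i = i'" if "i < 4 * n" "i' < 4 * n" "f i = f i'" for i i'
  proof -
    have "2 * n < i \<longleftrightarrow> 2 * n < i'"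
      using lower(1)[OF that(1)] lower(1)[OF that(2)] that(3) by simp
    then have "real i = real i' \<or> real (4 * n - i) = real (4 * n - i')"
      using arg_cong[OF that(3), of Re] unfolding lower(2)[OF that(1)] lower(2)[OF that(2)]
      by (simp only: not_less[symmetric]) (metis (full_types))
    then have "i = i' \<or> 4 * n - i = 4 * n - i'" by (simp only: of_nat_eq_iff)
    then show ?thesis using that(1,2) by linarith
  qed
  then have "distinct vs" by (auto simp: vs_def distinct_map inj_on_def)
  moreover have "length vs \<ge> 3" using assms by (simp add: len)
  moreover have "edge n ` route n j = {{vs ! i, vs ! (Suc i mod length vs)} | i. i < length vs}"
  proof -
    have up: "{vs ! i, vs ! (Suc i mod length vs)} = edge n (lev i, i)" if "i < 2 * n" for i
      using that lev_next[of i] by (simp add: vs_def f_def edge_def)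
    \<comment> \<open>Both extreme cases use common end points: the way back starts at index
      \<open>2 n\<close>, listed on an upper layer, and its last edge closes up at index
      \<open>0\<close>.\<close>
    have down: "{vs ! i, vs ! (Suc i mod length vs)} = edge n (Bot, 4 * n - Suc i)"
      if "2 * n \<le> i" "i < 4 * n" for i
    proof -
      have "f i = pt n Bot (4 * n - i)"
        using that pt_ends(2)[of n "lev i" Bot] by (auto simp: f_def le_less)
      moreover have "f (Suc i mod (4 * n)) = pt n Bot (4 * n - Suc i)"
        using that assms pt_ends(1)[of n "lev 0" Bot] by (cases "Suc i = 4 * n") (auto simp: f_def)
      moreover have "4 * n - i = Suc (4 * n - Suc i)" using that by simp
      ultimately show ?thesis
        using that by (simp add: vs_def edge_def insert_commute)
    qed
    show ?thesis (is "?L = ?R")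
    proof (intro equalityI subsetI)
      fix e assume "e \<in> ?L"
      then obtain l k where k: "k < 2 * n" "l = Bot \<or> l = lev k" and e: "e = edge n (l, k)"
        by (auto simp: route_def lev_def)
      from k(2) show "e \<in> ?R"
      proof
        assume "l = Bot"
        then have "e = {vs ! (4 * n - Suc k), vs ! (Suc (4 * n - Suc k) mod length vs)}"
          using down[of "4 * n - Suc k"] k e by simp
        then show ?thesis using k len by fastforce
      next
        assume "l = lev k"
        then have "e = {vs ! k, vs ! (Suc k mod length vs)}" using up[of k] k e by simp
        then show ?thesis using k len by fastforce
      qed
    next
      fix e assume "e \<in> ?R"
      then obtain i where i: "i < 4 * n" and e: "e = {vs ! i, vs ! (Suc i mod length vs)}"
        using len by auto
      show "e \<in> ?L"
      proof (cases "i < 2 * n")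
        case True
        then show ?thesis using up[of i] e by (auto simp: route_def lev_def)
      next
        case False
        then have "e = edge n (Bot, 4 * n - Suc i)" using down[of i] i e by simp
        moreover have "(Bot, 4 * n - Suc i) \<in> route n j" using i False by (auto simp: route_def)
        ultimately show ?thesis by blast
      qed
    qed
  qed
  moreover have "edge n ` route n j \<subseteq> edges n"
    using route_subset_slots by (auto simp: edges_def)
  ultimately show ?thesis unfolding is_cycle_def by blast
qed

section \<open>Cycles with the signature of a route\<close>

lemma cycle_continues:
  assumes "is_cycle (edges n) (edge n ` A)" "A \<subseteq> slots n" "Suc k < 2 * n"
    and sole: "\<And>l'. l' \<noteq> l \<Longrightarrow> curve n l' (real (Suc k)) \<noteq> curve n l (real (Suc k))"
  shows "(l, k) \<in> A \<longleftrightarrow> (l, Suc k) \<in> A"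
proof -
  \<comment> \<open>By \<open>sole\<close> no other layer passes through this vertex, so only two
    edges can contain it; a cycle without leaves uses both or neither.\<close>
  have at: "l' = l \<and> (k' = k \<or> k' = Suc k)" if "pt n l (Suc k) \<in> edge n (l', k')" for l' k'
    using that sole[of l'] by (cases "l' = l") (auto simp: edge_def pt_eq_iff simp del: of_nat_Suc)
  \<comment> \<open>The two ways of assigning \<open>a\<close> and \<open>b\<close> give the two
    implications.\<close>
  have "(l, b) \<in> A" if a: "(l, a) \<in> A" and ab: "{a, b} = {k, Suc k}" for a b
  proof -
    have "pt n l (Suc k) \<in> edge n (l, a)" using ab by (auto simp: doubleton_eq_iff pt_in_edge)
    with assms(1) imageI[OF a]
    obtain e' where "e' \<in> edge n ` A" "e' \<noteq> edge n (l, a)" "pt n l (Suc k) \<in> e'"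
      by (rule cycle_no_leaf)
    then obtain l' k' where "(l', k') \<in> A" "(l', k') \<noteq> (l, a)" "pt n l (Suc k) \<in> edge n (l', k')"
      by auto
    then show ?thesis using at[of l' k'] ab by (auto simp: doubleton_eq_iff)
  qed
  then show ?thesis by (metis insert_commute)
qed

text \<open>The belly sees all \<open>2 n\<close> edges of \<open>Bot\<close> and the two
  \<open>Mid\<close> edges of lens \<open>j\<close>. Neither value depends on
  \<open>j\<close>.\<close>

lemma route_counts:
  shows "i < n \<Longrightarrow> card (({Mid, Top} \<times> {2 * i..<2 * i + 2}) \<inter> route n j) = 2"
    and "j < n \<Longrightarrow> card (({Bot, Mid} \<times> {0..<2 * n}) \<inter> route n j) = 2 * n + 2"
proof -
  assume "i < n"
  then have "({Mid, Top} \<times> {2 * i..<2 * i + 2}) \<inter> route n j =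
      {(if i = j then Mid else Top, 2 * i), (if i = j then Mid else Top, 2 * i + 1)}"
    by (auto simp: route_def split: if_splits)
  then show "card (({Mid, Top} \<times> {2 * i..<2 * i + 2}) \<inter> route n j) = 2"
    by simp
next
  assume "j < n"
  then have "({Bot, Mid} \<times> {0..<2 * n}) \<inter> route n j =
      ({Bot} \<times> {0..<2 * n}) \<union> ({Mid} \<times> {2 * j, 2 * j + 1})"
    by (auto simp: route_def split: if_splits)
  moreover have "card (({Bot} \<times> {0..<2 * n}) \<union> ({Mid} \<times> {2 * j, 2 * j + 1})) = 2 * n + 2"
    by (subst card_Un_disjoint) (auto simp: card_cartesian_product)
  ultimately show "card (({Bot, Mid} \<times> {0..<2 * n}) \<inter> route n j) = 2 * n + 2"
    by simp
qed

text \<open>Being a cycle enters only through \<open>pair\<close> and \<open>Bot\<close>; the rest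
  is counting.\<close>

lemma eq_route_if_counts:
  assumes "n > 0" "A \<subseteq> slots n"
    and pair: "\<And>l i. i < n \<Longrightarrow> (l, 2 * i) \<in> A \<longleftrightarrow> (l, 2 * i + 1) \<in> A"
    and Bot: "\<And>k. Suc k < 2 * n \<Longrightarrow> (Bot, k) \<in> A \<longleftrightarrow> (Bot, Suc k) \<in> A"
    and lens: "\<And>i. i < n \<Longrightarrow> card (({Mid, Top} \<times> {2 * i..<2 * i + 2}) \<inter> A) = 2"
    and belly: "card (({Bot, Mid} \<times> {0..<2 * n}) \<inter> A) = 2 * n + 2"
  shows "\<exists>j<n. A = route n j"
proof -
  have all_Bot: "(Bot, k) \<in> A \<longleftrightarrow> (Bot, 0) \<in> A" if "k < 2 * n" for k
    using that by (induction k) (auto simp: Bot)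
  define M where "M = {k. k < 2 * n \<and> (Mid, k) \<in> A}"
  define B where "B = {k. k < 2 * n \<and> (Bot, k) \<in> A}"
  have fin: "finite M" "finite B" by (auto simp: M_def B_def)
  have "({Bot, Mid} \<times> {0..<2 * n}) \<inter> A = ({Bot} \<times> B) \<union> ({Mid} \<times> M)"
    by (auto simp: M_def B_def)
  then have "card B + card M = 2 * n + 2"
    using belly fin by (simp add: card_Un_disjoint card_cartesian_product Int_commute disjoint_iff)
  \<comment> \<open>\<open>Mid\<close> alone contributes at most \<open>2 n\<close>, so the value
    \<open>2 n + 2\<close> needs an edge of \<open>Bot\<close>, and then all of them.\<close>
  moreover have "card M \<le> card {..<2 * n}"
    by (rule card_mono) (auto simp: M_def)
  ultimately have "B \<noteq> {}" by auto
  then have "(Bot, 0) \<in> A"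
    using all_Bot by (force simp only: B_def)
  then have Bot_in: "(Bot, k) \<in> A" if "k < 2 * n" for k
    using all_Bot[OF that] by simp
  then have "B = {..<2 * n}" by (auto simp: B_def)
  \<comment> \<open>Two edges of \<open>Mid\<close> remain, and by \<open>pair\<close> they form the
    lower side of a single lens.\<close>
  then have "card M = 2" using \<open>card B + card M = 2 * n + 2\<close> by simp
  then obtain k where k: "k \<in> M" by fastforce
  define j where "j = k div 2"
  have j: "j < n" using k by (auto simp: M_def j_def)
  have "{2 * j, 2 * j + 1} \<subseteq> M"
    using k pair[OF j, of Mid] j by (cases "even k") (auto simp: M_def j_def elim!: evenE oddE)
  then have M: "M = {2 * j, 2 * j + 1}"
    using card_subset_eq[OF fin(1), of "{2 * j, 2 * j + 1}"] \<open>card M = 2\<close> by simp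
  \<comment> \<open>Each side of a lens contributes 0 or 2, so the value 2 means that exactly one
    side is used.\<close>
  have switch: "(Top, 2 * i) \<in> A \<longleftrightarrow> (Mid, 2 * i) \<notin> A" if i: "i < n" for i
  proof -
    have "{2 * i..<2 * i + 2} = {2 * i, 2 * i + 1}" by auto
    then have "({Mid, Top} \<times> {2 * i..<2 * i + 2}) \<inter> A =
        (if (Mid, 2 * i) \<in> A then {(Mid, 2 * i), (Mid, 2 * i + 1)} else {}) \<union>
        (if (Top, 2 * i) \<in> A then {(Top, 2 * i), (Top, 2 * i + 1)} else {})"
      using pair[OF i] by auto
    then show ?thesis using lens[OF i] by (auto split: if_splits)
  qed
  have "(l, k) \<in> A \<longleftrightarrow> (l, k) \<in> route n j" if k: "k < 2 * n" for l k
  proof -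
    have Mid: "(Mid, k) \<in> A \<longleftrightarrow> k div 2 = j" if "k < 2 * n" for k
    proof -
      have "(Mid, k) \<in> A \<longleftrightarrow> k = 2 * j \<or> k = 2 * j + 1" using M that by (auto simp: M_def)
      then show ?thesis by presburger
    qed
    have "k div 2 < n" using k by auto
    then have "(Top, k) \<in> A \<longleftrightarrow> (Top, 2 * (k div 2)) \<in> A"
      using pair[of "k div 2" Top] by (cases "even k") (auto elim!: evenE oddE)
    then have "(Top, k) \<in> A \<longleftrightarrow> k div 2 \<noteq> j"
      using switch[of "k div 2"] Mid[of "2 * (k div 2)"] \<open>k div 2 < n\<close> by simp
    then show ?thesis using Mid[OF k] Bot_in[OF k] k by (cases l) (auto simp: route_def)
  qed
  then have "A = route n j"
    using assms(2) route_subset_slots[of n j] unfolding slots_def by fast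
  then show ?thesis using j by blast
qed

lemma cycle_eq_route_if_signature_eq:
  assumes "n > 0" "j < n" "is_cycle (edges n) C"
    and sig: "signature (verts n) (edges n) (arcs n) C =
      signature (verts n) (edges n) (arcs n) (edge n ` route n j)"
  shows "\<exists>i<n. C = edge n ` route n i"
proof -
  have "C \<subseteq> edge n ` slots n" using assms(3) by (simp add: is_cycle_def edges_def)
  then obtain A where A: "A \<subseteq> slots n" "C = edge n ` A" by (auto simp: subset_image_iff)
  note cycle = assms(3)[unfolded A(2)]
  have counts: "\<forall>i<n. card (({Mid, Top} \<times> {2 * i..<2 * i + 2}) \<inter> A) = 2"
    "card (({Bot, Mid} \<times> {0..<2 * n}) \<inter> A) = 2 * n + 2"
    using sig[unfolded A(2) signature_eq_iff[OF assms(1) A(1) route_subset_slots]]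
      route_counts assms(2) by auto
  have "\<exists>i<n. A = route n i"
  proof (rule eq_route_if_counts[OF assms(1) A(1)])
    \<comment> \<open>The abscissa \<open>2 i + 1\<close> between the two edges is odd, and no two
      layers meet there.\<close>
    fix l i assume "i < n"
    then show "(l, 2 * i) \<in> A \<longleftrightarrow> (l, 2 * i + 1) \<in> A"
      using cycle_continues[OF cycle A(1), of "2 * i" l]
        curve_agree_nat_imp_even[of n _ "Suc (2 * i)" l] by force
  next
    \<comment> \<open>Strictly between the ends \<open>Bot\<close> is negative and the other layers
      are not.\<close>
    fix k assume k: "Suc k < 2 * n"
    then have "curve n Bot (real (Suc k)) < 0" by (intro curve_Bot_neg) auto
    then have "curve n l' (real (Suc k)) \<noteq> curve n Bot (real (Suc k))" if "l' \<noteq> Bot" for l'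
      using that curve_Top_nonneg[of n "real (Suc k)"] by (cases l') (auto simp: curve.simps(2))
    then show "(Bot, k) \<in> A \<longleftrightarrow> (Bot, Suc k) \<in> A"
      using cycle_continues[OF cycle A(1) k] by blast
  qed (use counts in auto)
  then show ?thesis using A(2) by blast
qed

section \<open>Counting the cycles of one signature\<close>

theorem theorem8:
  fixes s :: nat
  assumes "s \<ge> 1"
  shows "\<exists>V E \<gamma> C. plane_graph V E \<gamma> \<and> connected_graph V E \<and> bridgeless E \<and>
           is_cycle E C \<and> signature_multiplicity V E \<gamma> (signature V E \<gamma> C) = s"
proof -
  have s: "s > 0" using assms by simp
  let ?sig = "signature (verts s) (edges s) (arcs s)"
  let ?C = "\<lambda>j. edge s ` route s j"
  have "?sig (?C j) = ?sig (?C 0)" if "j < s" for j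
    using signature_eq_iff[OF s route_subset_slots route_subset_slots] route_counts that s by simp
  then have "{C. is_cycle (edges s) C \<and> ?sig C = ?sig (?C 0)} = ?C ` {..<s}"
    using cycle_eq_route_if_signature_eq[OF s s] is_cycle_route[OF s] by blast
  moreover have "inj_on ?C {..<s}"
  proof (rule inj_onI)
    fix i j assume "i \<in> {..<s}" "j \<in> {..<s}" "?C i = ?C j"
    from this(3) have "route s i = route s j"
      by (rule inj_on_image_eq_iff[OF inj_on_edge route_subset_slots route_subset_slots, THEN iffD1])
    \<comment> \<open>This slot belongs to no route of another index, so different indices give
      different cycles.\<close>
    moreover have "(Mid, 2 * i) \<in> route s i" using \<open>i \<in> {..<s}\<close> by (simp add: route_def)
    ultimately have "(Mid, 2 * i) \<in> route s j" by simp
    then show "i = j" by (simp add: route_def split: if_splits)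
  qed
  ultimately have "signature_multiplicity (verts s) (edges s) (arcs s) (?sig (?C 0)) = s"
    by (simp add: signature_multiplicity_def card_image)
  then show ?thesis
    using plane_graph_edges connected_graph_edges bridgeless_edges is_cycle_route[OF s] by blast
qed

end
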